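(* Let $n\in\mathbb{N}$, $\mathcal{N}=\{1,\dots,n\}$, let $d_1,\dots,d_n\in\mathbb{R}^2$ be displacement vectors, and let $C_i,\lambda_i>0$ ($i\in\mathcal{N}$), $L\in\mathbb{N}$ and $\mu>0$ be constants. Then there exists a constant $\check T^*>0$ such that the following holds. Let $(t_k)_{k\in\mathbb{N}_0}\subset\mathbb{R}_{\ge 0}$ be communication instants with $\check T\le t_{k+1}-t_k\le \hat T$ for all $k\in\mathbb{N}_0$, where $0<\check T\le\hat T<\infty$, and let $H_k=[h_{ij,k}]\in\mathbb{R}^{n\times n}$ be the normalized channel matrices (defined in the context), satisfying $$\tau_1(H_{k+L-1}\cdots H_k)\le 1-\mu\qquad\text{for all }k\in\mathbb{N}_0 .$$ Let the agent positions $p_i(t)\in\mathbb{R}^2$ and references $r_i(t)\in\mathbb{R}^2$, $i\in\mathcal{N}$, evolve according to the jump-flow system: for all $i\in\mathcal{N}$, $k\in\mathbb{N}_0$, $$r_{i,k^+}=d_i+\sum_{j=1}^n h_{ij,k}\,(p_{j}(t_k)-d_j),\qquad p_{i,k^+}=p_i(t_k),\qquad r_i(t)=r_{i,k^+}\ \text{ for } t\in(t_k,t_{k+1}],$$ and, under the tracking input of each agent, $$\|p_i(t)-r_{i,k^+}\|\le C_i e^{-\lambda_i(t-t_k)}\|p_i(t_k)-r_{i,k^+}\|\qquad\text{for all }t\in(t_k,t_{k+1}].$$ If $\check T>\check T^*$ (so that $t_{k+1}-t_k>\check T^*$ for all $k$), then the desired formation is achieved asymptotically: there exists a function $c:\mathbb{R}_{\ge0}\to\mathbb{R}^2$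 such that $$\lim_{t\to\infty}\|p_i(t)-c(t)-d_i\|=0\qquad\text{for all } i\in\mathcal{N}.$$
   Context: $\|\cdot\|$ is the Euclidean norm. A square matrix $A\in\mathbb{R}^{n\times n}$ is row-stochastic if it is entrywise nonnegative and each row sums to $1$; its coefficient of ergodicity is $\tau_1(A)=\frac12\max_{i,j}\sum_{s=1}^n|A_{is}-A_{js}|$. Agents: agent $i$ has dynamics $\dot x_i=f_i(t,x_i,u_i)$ with position output $p_i=g_i(t,x_i)\in\mathbb{R}^2$. The only assumption on the (possibly heterogeneous) agents is exponential tracking of constant references: there exist $C_i,\lambda_i>0$ such that for any constant reference $r_i\in\mathbb{R}^2$ there is an input $u_i$ for which $\|p_i(t)-r_i\|\le C_ie^{-\lambda_i(t-\tau)}\|p_i(\tau)-r_i\|$ for all $t\ge\tau\ge0$. On each interval $(t_k,t_{k+1}]$ agent $i$ applies such an input for the reference $r_{i,k^+}$, which gives the flow inequality in the claim. The subscript $k^+$ denotes a value immediately after the update at $t_k$. Normalized channel matrices: at each $t_k$ agent $i$ has a neighbor set $\mathcal{N}_{i,k}\subseteq\mathcal{N}$ with $i\in\mathcal{N}_{i,k}$ and (unknown) channel coefficients $\xi_{ij,k}\in(0,1]$ for $j\in\mathcal{N}_{i,k}$. One sets $h_{ij,k}=\xi_{ij,k}/\sum_{l\in\mathcal{N}_{i,k}}\xi_{il,k}$ if $j\in\mathcal{N}_{i,k}$ and $h_{ij,k}=0$ otherwise; hence each $H_k$ is row-stochastic. *)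

theory Defs
  imports "HOL-Analysis.Analysis"
begin

definition row_stochastic :: "real ^ 'n ^ 'n \<Rightarrow> bool" where
  "row_stochastic A \<longleftrightarrow> (\<forall>i j. 0 \<le> A $ i $ j) \<and> (\<forall>i. (\<Sum>j\<in>UNIV. A $ i $ j) = 1)"

definition ergodicity_coeff :: "real ^ 'n ^ 'n \<Rightarrow> real" where
  "ergodicity_coeff A =
     1 / 2 * Max (range (\<lambda>(i, j). \<Sum>s\<in>UNIV. \<bar>A $ i $ s - A $ j $ s\<bar>))"

text \<open>One communication instant: \<open>Nb i\<close> is the neighbour set of agent \<open>i\<close>. Values \<open>xi i j\<close> with
  \<open>j \<notin> Nb i\<close> are unconstrained and irrelevant.\<close>

definition channel_coeffs :: "('n \<Rightarrow> 'n set) \<Rightarrow> ('n \<Rightarrow> 'n \<Rightarrow> real) \<Rightarrow> bool" where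
  "channel_coeffs Nb xi \<longleftrightarrow> (\<forall>i. i \<in> Nb i \<and> (\<forall>j\<in>Nb i. xi i j \<in> {0<..1}))"

definition normalized_channel_matrix ::
    "('n \<Rightarrow> 'n set) \<Rightarrow> ('n \<Rightarrow> 'n \<Rightarrow> real) \<Rightarrow> real ^ 'n ^ 'n" where
  "normalized_channel_matrix Nb xi =
     (\<chi> i j. if j \<in> Nb i then xi i j / (\<Sum>l\<in>Nb i. xi i l) else 0)"

lemma row_stochastic_normalized_channel_matrix:
  fixes Nb :: "'n::finite \<Rightarrow> 'n set"
  assumes "channel_coeffs Nb xi"
  shows "row_stochastic (normalized_channel_matrix Nb xi)"
proof -
  have xi: "xi i j > 0" if "j \<in> Nb i" for i j
    using assms that by (auto simp: channel_coeffs_def)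
  have pos: "(\<Sum>l\<in>Nb i. xi i l) > 0" for i
    by (rule sum_pos) (use assms xi in \<open>auto simp: channel_coeffs_def\<close>)
  have "(\<Sum>j\<in>UNIV. normalized_channel_matrix Nb xi $ i $ j) = 1" for i
    using pos[of i]
    by (simp add: normalized_channel_matrix_def sum.If_cases flip: sum_divide_distrib)
  moreover have "0 \<le> normalized_channel_matrix Nb xi $ i $ j" for i j
    using pos[of i] xi[of j i] by (simp add: normalized_channel_matrix_def less_imp_le)
  ultimately show ?thesis
    by (simp add: row_stochastic_def)
qed

text \<open>\<open>backward_product H k L\<close> is $H_{k+L-1} \cdots H_k$: later matrices multiply from the left.\<close>

primrec backward_product :: "(nat \<Rightarrow> real ^ 'n ^ 'n) \<Rightarrow> nat \<Rightarrow> nat \<Rightarrow> real ^ 'n ^ 'n" where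
  "backward_product H k 0 = mat 1"
| "backward_product H k (Suc L) = H (k + L) ** backward_product H k L"

text \<open>\<open>r_plus i k\<close> and \<open>p_plus i k\<close> are the values \<open>r\<^sub>i\<close>, \<open>p\<^sub>i\<close> immediately after the update at \<open>t k\<close>
  (part of the hybrid state, not required to be one-sided limits). Positions and references are
  constrained only from \<open>t 0\<close> on; continuity of \<open>p\<close> is not required.\<close>

definition jump_flow_system ::
    "('n::finite \<Rightarrow> real ^ 2) \<Rightarrow> ('n \<Rightarrow> real) \<Rightarrow> ('n \<Rightarrow> real) \<Rightarrow> (nat \<Rightarrow> real) \<Rightarrow> (nat \<Rightarrow> real ^ 'n ^ 'n) \<Rightarrow>
     ('n \<Rightarrow> real \<Rightarrow> real ^ 2) \<Rightarrow> ('n \<Rightarrow> real \<Rightarrow> real ^ 2) \<Rightarrow>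
     ('n \<Rightarrow> nat \<Rightarrow> real ^ 2) \<Rightarrow> ('n \<Rightarrow> nat \<Rightarrow> real ^ 2) \<Rightarrow> bool" where
  "jump_flow_system d C lam t H p r p_plus r_plus \<longleftrightarrow>
     (\<forall>i k. r_plus i k = d i + (\<Sum>j\<in>UNIV. H k $ i $ j *\<^sub>R (p j (t k) - d j)) \<and>
            p_plus i k = p i (t k) \<and>
            (\<forall>s\<in>{t k<..t (Suc k)}. r i s = r_plus i k) \<and>
            (\<forall>s\<in>{t k<..t (Suc k)}.
               norm (p i s - r_plus i k)
                 \<le> C i * exp (- lam i * (s - t k)) * norm (p i (t k) - r_plus i k)))"

definition formation_achieved ::
    "('n \<Rightarrow> real ^ 2) \<Rightarrow> ('n \<Rightarrow> real \<Rightarrow> real ^ 2) \<Rightarrow> bool" where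
  "formation_achieved d p \<longleftrightarrow>
     (\<exists>c :: real \<Rightarrow> real ^ 2. \<forall>i. ((\<lambda>s. norm (p i s - c s - d i)) \<longlongrightarrow> 0) at_top)"

end

(* Let D k be the diameter of the displaced positions p_i(t_k) - d_i. Averaging by H_k moves each
   of them by at most D k, so one communication interval is averaging followed by an error of at
   most eps * D k, where eps = max_i C_i exp (- lam_i T_min). Over L intervals the averaging part
   contracts the diameter by the factor 1 - mu, while the accumulated error is at most
   L * eps * (1 + 2 * eps) ^ L * D k. For T_min large enough this leaves a contraction by
   1 - mu / 2, so D k tends to 0, and the flow inequality transfers this to all times. *)

theory Submission
  imports Defs
begin

section \<open>Diameter of a finite family of vectors\<close>

lemma norm_diff_le_diameter_range:
  fixes x :: "'n::finite \<Rightarrow> 'v::real_normed_vector"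
  shows "norm (x i - x j) \<le> diameter (range x)"
  using diameter_bounded_bound[of "range x" "x i" "x j"]
  by (simp add: finite_imp_bounded dist_norm)

lemma diameter_range_le:
  fixes x :: "'n::finite \<Rightarrow> 'v::real_normed_vector"
  assumes "\<And>i j. norm (x i - x j) \<le> B"
  shows "diameter (range x) \<le> B"
  by (rule diameter_le) (use assms in auto)

lemma diameter_range_nonneg:
  fixes x :: "'n::finite \<Rightarrow> 'v::real_normed_vector"
  shows "0 \<le> diameter (range x)"
  by (intro diameter_ge_0 finite_imp_bounded) simp

section \<open>Averaging with row-stochastic weights\<close>

definition average :: "real ^ 'n ^ 'n \<Rightarrow> ('n \<Rightarrow> 'v::real_vector) \<Rightarrow> 'n \<Rightarrow> 'v" where
  "average A x i = (\<Sum>j\<in>UNIV. A $ i $ j *\<^sub>R x j)"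

lemma average_mat_1 [simp]: "average (mat 1) x = x"
  by (simp add: average_def mat_def fun_eq_iff if_distrib[of "\<lambda>c. c *\<^sub>R _"] cong: if_cong)

lemma average_matrix_mult: "average (A ** B) x = average A (average B x)"
  unfolding average_def matrix_matrix_mult_def
  by (auto simp: fun_eq_iff scaleR_sum_left scaleR_sum_right intro: sum.swap)

lemma average_diff: "average A (\<lambda>j. x j - y j) i = average A x i - average A y i"
  by (simp add: average_def scaleR_diff_right sum_subtractf)

lemma average_const: "row_stochastic A \<Longrightarrow> average A (\<lambda>j. y) i = y"
  by (simp add: average_def row_stochastic_def flip: scaleR_sum_left)

lemma norm_average_le:
  fixes x :: "'n::finite \<Rightarrow> 'v::real_normed_vector"
  assumes "row_stochastic A" and "\<And>j. norm (x j) \<le> B"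
  shows "norm (average A x i) \<le> B"
proof -
  have "norm (average A x i) \<le> (\<Sum>j\<in>UNIV. A $ i $ j * B)"
    unfolding average_def
    by (rule sum_norm_le) (use assms in \<open>auto simp: row_stochastic_def intro: mult_left_mono\<close>)
  also have "\<dots> = B"
    using assms by (simp add: row_stochastic_def flip: sum_distrib_right)
  finally show ?thesis .
qed

text \<open>Averaging fixes constants, so \<open>average A x i - x j\<close> is itself an average of
  the vectors \<open>x l - x j\<close>. The case \<open>i = j\<close> bounds how far an agent is
  moved.\<close>

lemma norm_average_diff_le_diameter:
  fixes x :: "'n::finite \<Rightarrow> 'v::real_normed_vector"
  assumes "row_stochastic A"
  shows "norm (average A x i - x j) \<le> diameter (range x)"
  using norm_average_le[OF assms, of "\<lambda>l. x l - x j" _ i] norm_diff_le_diameter_range[of x]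
  by (simp add: average_diff average_const assms)

text \<open>The previous bound holds for every \<open>x l\<close>, hence also for their average with
  the weights of row \<open>j\<close>.\<close>

lemma norm_average_diff_average_le_diameter:
  fixes x :: "'n::finite \<Rightarrow> 'v::real_normed_vector"
  assumes "row_stochastic A"
  shows "norm (average A x i - average A x j) \<le> diameter (range x)"
  using norm_average_le[OF assms, of "\<lambda>l. average A x i - x l" _ j]
    norm_average_diff_le_diameter[OF assms, of x]
  by (simp add: average_diff average_const assms)

lemma row_stochastic_mat_1: "row_stochastic (mat 1)"
  by (simp add: row_stochastic_def mat_def)

lemma row_stochastic_matrix_mult:
  fixes A B :: "real ^ 'n::finite ^ 'n"
  assumes "row_stochastic A" and "row_stochastic B"
  shows "row_stochastic (A ** B)"
proof -
  have "(\<Sum>j\<in>UNIV. \<Sum>l\<in>UNIV. A $ i $ l * B $ l $ j) = 1" for i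
    by (subst sum.swap) (use assms in \<open>simp add: row_stochastic_def flip: sum_distrib_left\<close>)
  then show ?thesis
    using assms by (simp add: row_stochastic_def matrix_matrix_mult_def sum_nonneg)
qed

lemma row_stochastic_backward_product:
  fixes H :: "nat \<Rightarrow> real ^ 'n::finite ^ 'n"
  assumes "\<And>k. row_stochastic (H k)"
  shows "row_stochastic (backward_product H k l)"
  by (induction l) (simp_all add: row_stochastic_mat_1 row_stochastic_matrix_mult assms)

section \<open>The coefficient of ergodicity as a contraction factor for the diameter\<close>

lemma norm_sum_scaleR_le_diameter:
  fixes x :: "'n::finite \<Rightarrow> 'v::real_normed_vector" and w :: "'n \<Rightarrow> real"
  assumes w: "(\<Sum>s\<in>UNIV. w s) = 0"
  shows "norm (\<Sum>s\<in>UNIV. w s *\<^sub>R x s) \<le> (\<Sum>s\<in>UNIV. \<bar>w s\<bar>) / 2 * diameter (range x)"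
proof -
  \<comment> \<open>Positive and negative parts of \<open>w\<close>. As \<open>w\<close> sums to
    zero, both have the same mass \<open>m\<close>, which is half the sum of absolute
    values.\<close>
  define a where "a s = max (w s) 0" for s
  define b where "b s = max (- w s) 0" for s
  define m where "m = (\<Sum>s\<in>UNIV. a s)"
  have ab: "w s = a s - b s" "\<bar>w s\<bar> = a s + b s" "0 \<le> a s" "0 \<le> b s" for s
    by (auto simp: a_def b_def)
  have mb: "(\<Sum>s\<in>UNIV. b s) = m"
    using w by (simp add: ab(1) sum_subtractf m_def)
  have abs: "(\<Sum>s\<in>UNIV. \<bar>w s\<bar>) / 2 = m"
    using mb by (simp add: ab(2) sum.distrib m_def)
  have "m \<ge> 0"
    by (simp add: m_def sum_nonneg ab)
  let ?v = "\<Sum>s\<in>UNIV. w s *\<^sub>R x s"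
  \<comment> \<open>Transport argument: the positive mass is matched with the negative mass by the
    product coupling \<open>a s * b u\<close>, which leaves only differences
    \<open>x s - x u\<close>. Multiplying by \<open>m\<close> avoids normalizing the
    coupling.\<close>
  have "m *\<^sub>R ?v = (\<Sum>s\<in>UNIV. \<Sum>u\<in>UNIV. (a s * b u) *\<^sub>R (x s - x u))"
  proof -
    have "(\<Sum>s\<in>UNIV. \<Sum>u\<in>UNIV. (a s * b u) *\<^sub>R x s) = m *\<^sub>R (\<Sum>s\<in>UNIV. a s *\<^sub>R x s)"
      by (simp add: mb scaleR_sum_right mult.commute
          flip: scaleR_sum_left sum_distrib_left sum_distrib_right)
    moreover have "(\<Sum>s\<in>UNIV. \<Sum>u\<in>UNIV. (a s * b u) *\<^sub>R x u) = m *\<^sub>R (\<Sum>s\<in>UNIV. b s *\<^sub>R x s)"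
      by (subst sum.swap) (simp add: m_def scaleR_sum_right
          flip: scaleR_sum_left sum_distrib_left sum_distrib_right)
    ultimately show ?thesis
      by (simp add: ab(1) scaleR_diff_left scaleR_diff_right sum_subtractf)
  qed
  also have "norm \<dots> \<le> (\<Sum>s\<in>UNIV. \<Sum>u\<in>UNIV. a s * b u * diameter (range x))"
    by (intro sum_norm_le)
      (auto simp: ab abs_mult intro!: mult_left_mono norm_diff_le_diameter_range)
  also have "\<dots> = m * (m * diameter (range x))"
    by (simp add: mb m_def flip: sum_distrib_left sum_distrib_right)
  finally have le: "m * norm ?v \<le> m * (m * diameter (range x))"
    using \<open>m \<ge> 0\<close> by simp
  show ?thesis
  proof (cases "m = 0")
    case True
    then have "w s = 0" for s
      using abs by (simp add: sum_nonneg_eq_0_iff)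
    then show ?thesis by simp
  next
    case False
    with le \<open>m \<ge> 0\<close> show ?thesis by (simp add: abs)
  qed
qed

lemma half_row_distance_le_ergodicity_coeff:
  fixes A :: "real ^ 'n::finite ^ 'n"
  shows "(\<Sum>s\<in>UNIV. \<bar>A $ i $ s - A $ j $ s\<bar>) / 2 \<le> ergodicity_coeff A"
  unfolding ergodicity_coeff_def by (auto intro!: Max_ge image_eqI[of _ _ "(i, j)"])

text \<open>Together with the bound \<open>1 - mu\<close> this forces \<open>mu\<close> to be at
  most 1, which keeps the later contraction factor nonnegative. Comparing a row with itself
  suffices.\<close>

lemma ergodicity_coeff_nonneg: "0 \<le> ergodicity_coeff (A :: real ^ 'n::finite ^ 'n)"
  using half_row_distance_le_ergodicity_coeff[of A undefined undefined] by simp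

text \<open>The difference of two rows of a stochastic matrix sums to zero, so the transport bound
  applies to it.\<close>

lemma norm_average_diff_average_le_ergodicity_coeff:
  fixes x :: "'n::finite \<Rightarrow> 'v::real_normed_vector"
  assumes "row_stochastic A"
  shows "norm (average A x i - average A x j) \<le> ergodicity_coeff A * diameter (range x)"
proof -
  have "norm (average A x i - average A x j)
      = norm (\<Sum>s\<in>UNIV. (A $ i $ s - A $ j $ s) *\<^sub>R x s)"
    by (simp add: average_def scaleR_diff_left sum_subtractf)
  also have "\<dots> \<le> (\<Sum>s\<in>UNIV. \<bar>A $ i $ s - A $ j $ s\<bar>) / 2 * diameter (range x)"
    by (rule norm_sum_scaleR_le_diameter)
      (use assms in \<open>simp add: sum_subtractf row_stochastic_def\<close>)
  also have "\<dots> \<le> ergodicity_coeff A * diameter (range x)"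
    by (intro mult_right_mono half_row_distance_le_ergodicity_coeff diameter_range_nonneg)
  finally show ?thesis .
qed

section \<open>Averaging disturbed by small errors\<close>

lemma diameter_step_le:
  fixes x y :: "'n::finite \<Rightarrow> 'v::real_normed_vector"
  assumes "\<And>i j. norm (x i - x j) \<le> B" and "\<And>i. norm (y i - x i) \<le> e"
  shows "diameter (range y) \<le> B + 2 * e"
proof (rule diameter_range_le)
  fix i j
  have "norm (y i - y j) = norm ((x i - x j) + (y i - x i) - (y j - x j))"
    by (simp add: algebra_simps)
  also have "\<dots> \<le> norm (x i - x j) + norm (y i - x i) + norm (y j - x j)"
    by (intro order_trans[OF norm_triangle_ineq4] add_right_mono norm_triangle_ineq)
  also have "\<dots> \<le> B + 2 * e"
    using assms(1)[of i j] assms(2)[of i] assms(2)[of j] by simp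
  finally show "norm (y i - y j) \<le> B + 2 * e" .
qed

text \<open>The sampled dynamics without the flow. The error is relative to the current diameter, so
  it fades as agreement is approached and does not obstruct convergence.\<close>

locale perturbed_averaging =
  fixes H :: "nat \<Rightarrow> real ^ 'n::finite ^ 'n"
    and q :: "nat \<Rightarrow> 'n \<Rightarrow> 'v::real_normed_vector"
    and eps :: real
  assumes stochastic: "row_stochastic (H k)"
    and eps_nonneg: "0 \<le> eps"
    and error: "norm (q (Suc k) i - average (H k) (q k) i) \<le> eps * diameter (range (q k))"
begin

abbreviation "D k \<equiv> diameter (range (q k))"

lemma diameter_growth: "D (k + l) \<le> (1 + 2 * eps) ^ l * D k"
proof (induction l)
  case (Suc l)
  have "D (Suc (k + l)) \<le> D (k + l) + 2 * (eps * D (k + l))"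
    by (rule diameter_step_le[OF norm_average_diff_average_le_diameter error])
      (rule stochastic)
  also have "\<dots> = (1 + 2 * eps) * D (k + l)"
    by (simp add: algebra_simps)
  also have "\<dots> \<le> (1 + 2 * eps) * ((1 + 2 * eps) ^ l * D k)"
    using eps_nonneg by (intro mult_left_mono Suc) simp
  finally show ?case by (simp add: mult.assoc)
qed simp

text \<open>Stochastic matrices do not enlarge the largest error, so old errors are carried along
  without growth and the \<open>l\<close> contributions simply add up. The power accounts for the
  growth of the diameter in the meantime.\<close>

lemma accumulated_error:
  "norm (q (k + l) i - average (backward_product H k l) (q k) i)
    \<le> real l * eps * (1 + 2 * eps) ^ l * D k"
proof (induction l arbitrary: i)
  case (Suc l)
  let ?B = "backward_product H k l" and ?g = "(1 + 2 * eps) ^ l * D k"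
  have g: "0 \<le> ?g"
    using eps_nonneg by (simp add: diameter_range_nonneg)
  \<comment> \<open>The error of the newest step plus the average of the errors made before.\<close>
  have "q (k + Suc l) i - average (backward_product H k (Suc l)) (q k) i
      = (q (Suc (k + l)) i - average (H (k + l)) (q (k + l)) i)
        + average (H (k + l)) (\<lambda>j. q (k + l) j - average ?B (q k) j) i"
    by (simp add: average_matrix_mult average_diff)
  also have "norm \<dots> \<le> eps * ?g + real l * eps * ?g"
  proof (intro order_trans[OF norm_triangle_ineq] add_mono)
    show "norm (q (Suc (k + l)) i - average (H (k + l)) (q (k + l)) i) \<le> eps * ?g"
      by (rule order_trans[OF error mult_left_mono[OF diameter_growth eps_nonneg]])
    show "norm (average (H (k + l)) (\<lambda>j. q (k + l) j - average ?B (q k) j) i) \<le> real l * eps * ?g"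
      by (rule norm_average_le[OF stochastic]) (use Suc in \<open>simp add: mult.assoc\<close>)
  qed
  also have "\<dots> = real (Suc l) * eps * ?g"
    by (simp add: algebra_simps)
  \<comment> \<open>One spare factor \<open>1 + 2 * eps\<close> brings the exponent to
    \<open>Suc l\<close>.\<close>
  also have "\<dots> \<le> real (Suc l) * eps * ((1 + 2 * eps) * ?g)"
    using eps_nonneg g by (intro mult_left_mono) (auto simp: mult_le_cancel_right1 mult_right_mono)
  finally show ?case by (simp add: mult.assoc)
qed simp

text \<open>The undisturbed block contracts by \<open>1 - mu\<close>; the accumulated error counts
  twice, once for each end of a pair.\<close>

lemma diameter_contraction:
  assumes "ergodicity_coeff (backward_product H k L) \<le> 1 - mu"
  shows "D (k + L) \<le> (1 - mu + 2 * (real L * eps * (1 + 2 * eps) ^ L)) * D k"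
proof -
  let ?B = "backward_product H k L"
  have "norm (average ?B (q k) i - average ?B (q k) j) \<le> (1 - mu) * D k" for i j
    by (rule order_trans[OF norm_average_diff_average_le_ergodicity_coeff])
      (use assms in \<open>auto intro: mult_right_mono diameter_range_nonneg
        row_stochastic_backward_product stochastic\<close>)
  from diameter_step_le[where y = "q (k + L)", OF this accumulated_error] show ?thesis
    by (simp add: algebra_simps)
qed

end

section \<open>Limits: block contraction, the communication instants, the tracking factors\<close>

lemma tendsto_zero_of_block_contraction:
  fixes D :: "nat \<Rightarrow> real"
  assumes "\<And>k. 0 \<le> D k" and "L \<ge> 1" and "0 \<le> rho" "rho < 1" and "1 \<le> G"
    and growth: "\<And>k l. D (k + l) \<le> G ^ l * D k"
    and contr: "\<And>k. D (k + L) \<le> rho * D k"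
  shows "D \<longlonglongrightarrow> 0"
proof -
  have blocks: "D (m * L) \<le> rho ^ m * D 0" for m
  proof (induction m)
    case (Suc m)
    have "D (Suc m * L) \<le> rho * D (m * L)"
      using contr[of "m * L"] by (simp add: add.commute)
    also have "\<dots> \<le> rho * (rho ^ m * D 0)"
      using Suc \<open>0 \<le> rho\<close> by (rule mult_left_mono)
    finally show ?case by (simp add: mult.assoc)
  qed simp
  \<comment> \<open>The \<open>k mod L\<close> steps after the last full block cost at most
    \<open>G ^ L\<close>, because \<open>G\<close> is at least 1.\<close>
  have bound: "D k \<le> G ^ L * (rho ^ (k div L) * D 0)" for k
  proof -
    have "D k = D (k div L * L + k mod L)"
      by simp
    also have "\<dots> \<le> G ^ (k mod L) * D (k div L * L)"
      by (rule growth)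
    also have "\<dots> \<le> G ^ L * (rho ^ (k div L) * D 0)"
      using assms by (intro mult_mono blocks power_increasing) auto
    finally show ?thesis .
  qed
  have "filterlim (\<lambda>k. k div L) at_top sequentially"
    unfolding filterlim_at_top eventually_sequentially
  proof
    fix Z
    show "\<exists>N. \<forall>k\<ge>N. Z \<le> k div L"
      using \<open>L \<ge> 1\<close> div_le_mono[of "Z * L" _ L] by (intro exI[of _ "Z * L"]) auto
  qed
  then have "(\<lambda>k. rho ^ (k div L)) \<longlonglongrightarrow> 0"
    by (rule filterlim_compose[OF LIMSEQ_realpow_zero[OF \<open>0 \<le> rho\<close> \<open>rho < 1\<close>]])
  then have "(\<lambda>k. G ^ L * (rho ^ (k div L) * D 0)) \<longlonglongrightarrow> 0"
    by (auto intro!: tendsto_eq_intros)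
  then show ?thesis
    by (rule real_tendsto_sandwich[OF _ _ tendsto_const, rotated 2]) (use assms(1) bound in auto)
qed

text \<open>Gaps of at least \<delta> make the instants unbounded. The first instant from
  \<open>t K\<close> on that reaches \<open>s\<close> is not \<open>t K\<close> itself, so it has a
  predecessor, the left end of the interval.\<close>

lemma exists_interval_after:
  fixes t :: "nat \<Rightarrow> real"
  assumes "\<delta> > 0" and "\<And>k. \<delta> \<le> t (Suc k) - t k" and "t K < s"
  obtains k where "k \<ge> K" "t k < s" "s \<le> t (Suc k)"
proof -
  have lower: "t K + real m * \<delta> \<le> t (K + m)" for m
  proof (induction m)
    case (Suc m)
    then show ?case using assms(2)[of "K + m"] by (simp add: algebra_simps)
  qed simp
  obtain m where "s - t K < real m * \<delta>"
    using reals_Archimedean3[OF \<open>\<delta> > 0\<close>] by blast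
  with lower[of m] have ex: "s \<le> t (K + m)"
    by linarith
  define l where "l = (LEAST m. s \<le> t (K + m))"
  have l: "s \<le> t (K + l)"
    unfolding l_def by (rule LeastI[of _ m]) (rule ex)
  with \<open>t K < s\<close> obtain l' where l': "l = Suc l'"
    by (cases l) auto
  then have "\<not> s \<le> t (K + l')"
    using not_less_Least[of l' "\<lambda>m. s \<le> t (K + m)"] by (simp add: l_def)
  with l l' show ?thesis
    by (intro that[of "K + l'"]) auto
qed

text \<open>Each factor decays to 0; finiteness of the set of agents yields one threshold for all of
  them.\<close>

lemma eventually_tracking_factors_le:
  fixes C lam :: "'n::finite \<Rightarrow> real"
  assumes "\<And>i. lam i > 0" and "e > 0"
  shows "eventually (\<lambda>T. \<forall>i. C i * exp (- lam i * T) \<le> e) at_top"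
proof (rule eventually_all_finite)
  fix i
  have "filterlim (\<lambda>T. lam i * T) at_top at_top"
    using assms(1) filterlim_ident by (rule filterlim_tendsto_pos_mult_at_top[OF tendsto_const])
  then have "filterlim (\<lambda>T. - lam i * T) at_bot at_top"
    by (simp add: filterlim_uminus_at_top)
  then have "((\<lambda>T. C i * exp (- lam i * T)) \<longlongrightarrow> 0) at_top"
    by (intro tendsto_mult_right_zero filterlim_compose[OF exp_at_bot])
  then show "eventually (\<lambda>T. C i * exp (- lam i * T) \<le> e) at_top"
    by (rule eventually_mono[OF order_tendstoD(2)[OF _ \<open>e > 0\<close>]]) simp
qed

section \<open>From small tracking factors to the formation\<close>

lemma formation_achieved_of_small_tracking_factors:
  fixes d :: "'n::finite \<Rightarrow> real ^ 2"
  assumes C: "\<And>i. C i > 0" and lam: "\<And>i. lam i > 0" and "L \<ge> 1" and "mu > 0"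
    and eps: "0 < eps" "eps \<le> 1" "2 * (real L * eps * 3 ^ L) \<le> mu / 2"
    and small: "\<And>i. C i * exp (- lam i * \<delta>) \<le> eps"
    and "\<delta> > 0" and gap: "\<And>k. \<delta> \<le> t (Suc k) - t k"
    and stoch: "\<And>k. row_stochastic (H k)"
    and erg: "\<And>k. ergodicity_coeff (backward_product H k L) \<le> 1 - mu"
    and sys: "jump_flow_system d C lam t H p r p_plus r_plus"
  shows "formation_achieved d p"
proof -
  \<comment> \<open>Subtracting the displacements turns the formation into a consensus
    problem.\<close>
  define q where "q k i = p i (t k) - d i" for k i
  have ref: "r_plus i k = d i + average (H k) (q k) i" for i k
    using sys by (simp add: jump_flow_system_def average_def q_def)
  have flow: "norm (p i s - d i - average (H k) (q k) i)
      \<le> C i * exp (- lam i * (s - t k)) * diameter (range (q k))"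
    if "t k < s" "s \<le> t (Suc k)" for i k s
  proof -
    have "norm (p i s - r_plus i k)
        \<le> C i * exp (- lam i * (s - t k)) * norm (p i (t k) - r_plus i k)"
      using sys that unfolding jump_flow_system_def by (meson greaterThanAtMost_iff)
    \<comment> \<open>The initial tracking error is the distance the averaging moves agent
      \<open>i\<close>.\<close>
    also have "norm (p i (t k) - r_plus i k) \<le> diameter (range (q k))"
      using norm_average_diff_le_diameter[OF stoch, of k "q k" i i]
      by (simp add: ref q_def norm_minus_commute algebra_simps)
    finally show ?thesis
      using C[of i] by (simp add: ref mult_left_mono algebra_simps)
  qed
  \<comment> \<open>The flow bound is taken at the right endpoint \<open>t (Suc k)\<close>, where at
    least \<delta> has elapsed.\<close>
  interpret perturbed_averaging H q eps
  proof
    fix k i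
    have "norm (q (Suc k) i - average (H k) (q k) i)
        \<le> C i * exp (- lam i * (t (Suc k) - t k)) * diameter (range (q k))"
      using flow[of k "t (Suc k)" i] gap[of k] \<open>\<delta> > 0\<close> by (simp add: q_def)
    also have "\<dots> \<le> C i * exp (- lam i * \<delta>) * diameter (range (q k))"
      using C[of i] lam[of i] gap[of k]
      by (intro mult_right_mono mult_left_mono) (auto simp: diameter_range_nonneg)
    also have "\<dots> \<le> eps * diameter (range (q k))"
      by (intro mult_right_mono small diameter_range_nonneg)
    finally show "norm (q (Suc k) i - average (H k) (q k) i) \<le> eps * diameter (range (q k))" .
  qed (use stoch eps in auto)
  have D: "D \<longlonglongrightarrow> 0"
  proof (rule tendsto_zero_of_block_contraction[where rho = "1 - mu / 2" and G = "1 + 2 * eps"])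
    fix k
    \<comment> \<open>Since \<open>eps\<close> is at most 1, the growth factor is at most 3; the
      error then uses up no more than half of \<open>mu\<close>.\<close>
    have "(1 + 2 * eps) ^ L \<le> 3 ^ L"
      using eps by (intro power_mono) auto
    then have "2 * (real L * eps * (1 + 2 * eps) ^ L) \<le> 2 * (real L * eps * 3 ^ L)"
      using eps by (intro mult_left_mono) auto
    with eps have "1 - mu + 2 * (real L * eps * (1 + 2 * eps) ^ L) \<le> 1 - mu / 2"
      by linarith
    then show "D (k + L) \<le> (1 - mu / 2) * D k"
      by (intro order_trans[OF diameter_contraction[OF erg]] mult_right_mono diameter_range_nonneg)
  next
    show "0 \<le> 1 - mu / 2"
      using ergodicity_coeff_nonneg[of "backward_product H 0 L"] erg[of 0] \<open>mu > 0\<close> by simp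
  qed (use eps assms in \<open>auto simp: diameter_range_nonneg diameter_growth\<close>)
  \<comment> \<open>The centre follows one arbitrary fixed agent, here
    \<open>undefined\<close>.\<close>
  define c where "c s = p undefined s - d undefined" for s
  \<comment> \<open>Inside an interval the exponential is only known to be at most 1, which leaves
    \<open>C i\<close> and \<open>C undefined\<close> for the two tracking errors; the 1 is for the
    spread of the averages.\<close>
  have bound: "norm (p i s - c s - d i) \<le> (C i + C undefined + 1) * D k"
    if s: "t k < s" "s \<le> t (Suc k)" for i k s
  proof -
    have track: "norm (p j s - d j - average (H k) (q k) j) \<le> C j * D k" for j
    proof -
      have "C j * exp (- lam j * (s - t k)) * D k \<le> C j * 1 * D k"
        using C[of j] lam[of j] s by (intro mult_right_mono mult_left_mono)
          (auto simp: diameter_range_nonneg)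
      with flow[OF s, of j] show ?thesis by simp
    qed
    let ?z = "average (H k) (q k)"
    have "p i s - c s - d i
        = (p i s - d i - ?z i) + (?z i - ?z undefined) - (p undefined s - d undefined - ?z undefined)"
      by (simp add: c_def)
    also have "norm \<dots> \<le> C i * D k + D k + C undefined * D k"
      by (intro order_trans[OF norm_triangle_ineq4] order_trans[OF norm_triangle_ineq] add_mono
          track norm_average_diff_average_le_diameter stoch)
    finally show ?thesis by (simp add: algebra_simps)
  qed
  have "((\<lambda>s. norm (p i s - c s - d i)) \<longlongrightarrow> 0) at_top" for i
    unfolding tendsto_iff
  proof (intro allI impI)
    fix e :: real
    assume "e > 0"
    have "(\<lambda>k. (C i + C undefined + 1) * D k) \<longlonglongrightarrow> 0"
      using D by (rule tendsto_mult_right_zero)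
    then have "\<forall>\<^sub>F k in sequentially. (C i + C undefined + 1) * D k < e"
      using \<open>e > 0\<close> by (rule order_tendstoD(2))
    then obtain K where K: "\<And>k. k \<ge> K \<Longrightarrow> (C i + C undefined + 1) * D k < e"
      unfolding eventually_sequentially by blast
    show "\<forall>\<^sub>F s in at_top. dist (norm (p i s - c s - d i)) 0 < e"
      using eventually_gt_at_top[of "t K"]
    proof eventually_elim
      case (elim s)
      \<comment> \<open>Every time after \<open>t K\<close> lies in an interval of index at least
        \<open>K\<close>, so the bound at the instants covers all later times.\<close>
      obtain k where "k \<ge> K" "t k < s" "s \<le> t (Suc k)"
        using exists_interval_after[of \<delta> t K s] \<open>\<delta> > 0\<close> gap elim by blast
      with bound[of k s i] K[of k] show ?case by simp
    qed
  qed
  then show ?thesis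
    unfolding formation_achieved_def by blast
qed

section \<open>Choice of the threshold\<close>

theorem theorem1:
  fixes d :: "'n::finite \<Rightarrow> real ^ 2"
    and C lam :: "'n \<Rightarrow> real"
    and L :: nat
    and mu :: real
  assumes "\<And>i. C i > 0" and "\<And>i. lam i > 0" and "L \<ge> 1" and "mu > 0"
  shows "\<exists>T_star > 0.
    \<forall>(t :: nat \<Rightarrow> real) (T_min :: real) (T_max :: real)
      (Nb :: nat \<Rightarrow> 'n \<Rightarrow> 'n set) (xi :: nat \<Rightarrow> 'n \<Rightarrow> 'n \<Rightarrow> real)
      (H :: nat \<Rightarrow> real ^ 'n ^ 'n)
      (p :: 'n \<Rightarrow> real \<Rightarrow> real ^ 2) (r :: 'n \<Rightarrow> real \<Rightarrow> real ^ 2)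
      (p_plus :: 'n \<Rightarrow> nat \<Rightarrow> real ^ 2) (r_plus :: 'n \<Rightarrow> nat \<Rightarrow> real ^ 2).
      0 < T_min \<longrightarrow> T_min \<le> T_max \<longrightarrow>
      (\<forall>k. 0 \<le> t k) \<longrightarrow>
      (\<forall>k. T_min \<le> t (Suc k) - t k \<and> t (Suc k) - t k \<le> T_max) \<longrightarrow>
      (\<forall>k. channel_coeffs (Nb k) (xi k)) \<longrightarrow>
      (\<forall>k. H k = normalized_channel_matrix (Nb k) (xi k)) \<longrightarrow>
      (\<forall>k. ergodicity_coeff (backward_product H k L) \<le> 1 - mu) \<longrightarrow>
      jump_flow_system d C lam t H p r p_plus r_plus \<longrightarrow>
      T_min > T_star \<longrightarrow>
      formation_achieved d p"
proof -
  \<comment> \<open>The second entry makes the error term \<open>2 * (real L * eps * 3 ^ L)\<close>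
    at most \<open>mu / 2\<close>; the cap 1 justifies the base 3.\<close>
  define eps where "eps = min 1 (mu / (4 * real L * 3 ^ L))"
  have pos: "4 * real L * 3 ^ L > 0"
    using \<open>L \<ge> 1\<close> by simp
  have eps: "0 < eps" "eps \<le> 1"
    using \<open>mu > 0\<close> pos by (auto simp: eps_def)
  have "eps \<le> mu / (4 * real L * 3 ^ L)"
    by (simp add: eps_def)
  then have "2 * (real L * eps * 3 ^ L) \<le> mu / 2"
    using pos by (simp add: pos_le_divide_eq algebra_simps)
  note eps = eps this
  \<comment> \<open>\<open>N\<close> is fixed by \<open>C\<close>, \<open>lam\<close>,
    \<open>L\<close> and \<open>mu\<close> alone, before instants, matrices and trajectories are
    chosen.\<close>
  obtain N where N: "\<And>T i. T \<ge> N \<Longrightarrow> C i * exp (- lam i * T) \<le> eps"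
    using eventually_tracking_factors_le[of lam eps C] assms(2) eps(1)
    unfolding eventually_at_top_linorder by blast
  show ?thesis
  \<comment> \<open>The maximum with 1 makes the threshold positive.\<close>
  proof (intro exI[of _ "max N 1"] conjI allI impI)
    fix t :: "nat \<Rightarrow> real" and T_min T_max :: real and Nb :: "nat \<Rightarrow> 'n \<Rightarrow> 'n set"
      and xi H p r p_plus r_plus
    assume "0 < T_min" and gap: "\<forall>k. T_min \<le> t (Suc k) - t k \<and> t (Suc k) - t k \<le> T_max"
      and ch: "\<forall>k. channel_coeffs (Nb k) (xi k)"
      and H: "\<forall>k. H k = normalized_channel_matrix (Nb k) (xi k)"
      and erg: "\<forall>k. ergodicity_coeff (backward_product H k L) \<le> 1 - mu"
      and sys: "jump_flow_system d C lam t H p r p_plus r_plus"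
      and T: "max N 1 < T_min"
    show "formation_achieved d p"
    proof (rule formation_achieved_of_small_tracking_factors[OF assms eps])
      show "C i * exp (- lam i * T_min) \<le> eps" for i
        using N T by simp
      show "row_stochastic (H k)" for k
        using H ch by (simp add: row_stochastic_normalized_channel_matrix)
    qed (use \<open>0 < T_min\<close> gap erg sys in auto)
  qed simp
qed

end
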